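(* Let $n\geq 0$ and let $u=u_1u_2\cdots u_{2n+1}\in A_{2n+1}(1243)$ have label $(a,b)$. Then the set of labels of the children of $u$ is $$\{(x,y)\,|\,1\leq x\leq a+1,\ x+2\leq y\leq b+2\}.$$
   Context: A permutation $\pi=\pi_1\pi_2\cdots\pi_m$ of $[m]=\{1,2,\ldots,m\}$ is alternating if $\pi_1<\pi_2>\pi_3<\pi_4>\cdots$. A permutation contains a pattern $\sigma\in S_k$ if it has a subsequence order isomorphic to $\sigma$; otherwise it avoids $\sigma$. $A_m(\sigma)$ denotes the set of alternating permutations of $[m]$ that avoid $\sigma$. Children: for $u\in A_{2n+1}(1243)$, a child of $u$ is a permutation $w=w_1w_2\cdots w_{2n+3}\in A_{2n+3}(1243)$ such that $w_3w_4\cdots w_{2n+3}$ is order isomorphic to $u$. For any $m\ge 0$ and $u=u_1\cdots u_{2m+1}\in A_{2m+1}(1243)$, define $$f(u)=\max\{0,\,u_j\,|\,\text{there exists } i \text{ such that } i<j \text{ and } u_i>u_j\},$$ $$e(u)=\max\{0,\,u_i\,|\,\text{there exist } j \text{ and } k \text{ such that } i<j<k \text{ and } u_i<u_k<u_j\}.$$ The label of $u\in A_{2m+1}(1243)$ is the pair $(a,b)$ with $$a=2m+2-\max\{u_1+1,f(u)+1\},\qquad b=2m+2-e(u).$$ (For instance the permutation $1\in A_1(1243)$ has label $(0,2)$.) The label of a child $w\in A_{2n+3}(1243)$ is given by the same formulas with $m=n+1$. *)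

theory Defs
  imports "HOL-Combinatorics.Multiset_Permutations" "HOL-Library.Sublist"
begin

(* A permutation of {1..m} is written in one-line notation as a list of naturals, i.e. as an element
   of permutations_of_set {1..m}. List positions count from 0, so the entry w_i of the usual
   1-based notation is w ! (i - 1). *)

definition order_isomorphic :: "nat list \<Rightarrow> nat list \<Rightarrow> bool" where
  "order_isomorphic v w \<longleftrightarrow>
     length v = length w \<and>
     (\<forall>i < length v. \<forall>j < length v. v ! i < v ! j \<longleftrightarrow> w ! i < w ! j)"

definition contains_pattern :: "nat list \<Rightarrow> nat list \<Rightarrow> bool" where
  "contains_pattern w \<sigma> \<longleftrightarrow> (\<exists>v. subseq v w \<and> order_isomorphic v \<sigma>)"

(* w_1 < w_2 > w_3 < ...: an ascent at each even 0-based position, a descent at each odd one. *)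
definition alternating :: "nat list \<Rightarrow> bool" where
  "alternating w \<longleftrightarrow>
     (\<forall>i. Suc i < length w \<longrightarrow> (if even i then w ! i < w ! Suc i else w ! i > w ! Suc i))"

definition alt_avoiding :: "nat \<Rightarrow> nat list \<Rightarrow> nat list set" where
  "alt_avoiding m \<sigma> =
     {w \<in> permutations_of_set {1..m}. alternating w \<and> \<not> contains_pattern w \<sigma>}"

(* Intended for u in alt_avoiding (2 * n + 1) [1, 2, 4, 3]. *)
definition children :: "nat \<Rightarrow> nat list \<Rightarrow> nat list set" where
  "children n u = {w \<in> alt_avoiding (2 * n + 3) [1, 2, 4, 3]. order_isomorphic (drop 2 w) u}"

definition f_stat :: "nat list \<Rightarrow> nat" where
  "f_stat u = Max ({0} \<union> {u ! j | j. j < length u \<and> (\<exists>i < j. u ! i > u ! j)})"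

definition e_stat :: "nat list \<Rightarrow> nat" where
  "e_stat u = Max ({0} \<union> {u ! i | i. \<exists>j k. i < j \<and> j < k \<and> k < length u \<and>
                                        u ! i < u ! k \<and> u ! k < u ! j})"

(* The label of a permutation u of length 2 * m + 1; integer-valued to avoid truncated subtraction. *)
definition label :: "nat \<Rightarrow> nat list \<Rightarrow> int \<times> int" where
  "label m u =
     (2 * int m + 2 - max (int (u ! 0) + 1) (int (f_stat u) + 1),
      2 * int m + 2 - int (e_stat u))"

lemma label_singleton: "label 0 [1] = (0, 2)"
proof -
  have "f_stat [1] = 0" "e_stat [1] = 0"
    by (simp_all add: f_stat_def e_stat_def)
  then show ?thesis by (simp add: label_def)
qed

end

theory Submission
  imports Defs
begin

text \<open>
  A child of \<open>u\<close> is determined by its first two entries \<open>p < q\<close>: the rest is \<open>u\<close> with its values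
  spread out so as to omit \<open>p\<close> and \<open>q\<close> (\<open>children_tail\<close>). Write \<open>f\<close>, \<open>e\<close> for the two statistics
  of \<open>u\<close>. If a copy of 1243 uses a new entry, there is one that either consists of \<open>p\<close> and a 132
  above \<open>p\<close> in the old part, or of \<open>p\<close>, \<open>q\<close> and an inversion above \<open>q\<close> in the old part. The first
  is excluded iff \<open>e < p\<close>, the second iff \<open>f + 2 \<le> q\<close>; the descent after \<open>q\<close>
  requires that \<open>u\<^sub>1 + 2 \<le> q\<close>. So the children correspond to the pairs \<open>p < q \<le> 2n + 3\<close> with
  \<open>e < p\<close> and \<open>max u\<^sub>1 f + 2 \<le> q\<close> (\<open>children_eq\<close>).

  In such a child every value below \<open>q\<close> other than \<open>p\<close> comes after \<open>q\<close>, and every value above \<open>q\<close>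
  has no larger entry before it. Hence the larger of its first entry and its \<open>f\<close>-statistic is
  \<open>q - 1\<close>, and the first component of its label is \<open>2n + 4 - q\<close>. Its \<open>e\<close>-statistic is \<open>p\<close> if some
  value lies strictly between \<open>p\<close> and \<open>q\<close>, since \<open>p\<close>, \<open>q\<close> and that value form a 132 and none
  starts higher; if \<open>q = p + 1\<close>, no 132 starts with \<open>p\<close>, and the statistic is still \<open>e\<close>. As \<open>p\<close>
  runs through its range for fixed \<open>q\<close>, the \<open>e\<close>-statistic therefore takes every value from \<open>e\<close> (at \<open>p = q - 1\<close>) to
  \<open>q - 2\<close>; the case \<open>p = q - 1\<close> does occur, because \<open>e \<le> f\<close>. In terms of labels these are the
  claimed intervals.
\<close>

section \<open>Patterns and statistics in terms of subsequences\<close>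

text \<open>
  Subsequences obey a simple recursion on the list, so stating the pattern and both statistics with
  them makes it easy to see what two entries put in front contribute.
\<close>

lemma subseq_Cons_iff:
  "subseq (x # xs) (y # ys) \<longleftrightarrow> subseq (x # xs) ys \<or> x = y \<and> subseq xs ys"
  by (auto simp: subseq_Cons2_iff dest: subseq_Cons')

lemma subseq_Cons_nth_iff:
  "subseq (x # xs) w \<longleftrightarrow> (\<exists>i < length w. w ! i = x \<and> subseq xs (drop (Suc i) w))"
proof (induction w)
  case (Cons y w)
  then show ?case
    unfolding subseq_Cons_iff by (auto simp: less_Suc_eq_0_disj)
qed auto

lemma subseq_pair_iff:
  "subseq [x, y] w \<longleftrightarrow> (\<exists>i j. i < j \<and> j < length w \<and> x = w ! i \<and> y = w ! j)" (is "?L \<longleftrightarrow> ?R")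
proof
  assume ?L
  then obtain i j where "i < length w" "w ! i = x"
    "j < length (drop (Suc i) w)" "drop (Suc i) w ! j = y"
    by (auto simp: subseq_Cons_nth_iff)
  then show ?R by (intro exI[of _ i] exI[of _ "Suc i + j"]) auto
next
  assume ?R
  then obtain i j where *: "i < j" "j < length w" "x = w ! i" "y = w ! j" by blast
  then have "y \<in> set (drop (Suc i) w)"
    by (auto simp: in_set_conv_nth intro!: exI[of _ "j - Suc i"])
  with * show ?L
    unfolding subseq_Cons_nth_iff[of x] by (intro exI[of _ i]) (simp add: subseq_singleton_left)
qed

lemma subseq_triple_iff:
  "subseq [x, z, y] w \<longleftrightarrow>
    (\<exists>i j k. i < j \<and> j < k \<and> k < length w \<and> x = w ! i \<and> z = w ! j \<and> y = w ! k)" (is "?L \<longleftrightarrow> ?R")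
proof
  assume ?L
  then obtain i j k where "i < length w" "w ! i = x" "j < k"
    "k < length (drop (Suc i) w)" "drop (Suc i) w ! j = z" "drop (Suc i) w ! k = y"
    by (auto simp: subseq_Cons_nth_iff[of x] subseq_pair_iff)
  then show ?R
    by (intro exI[of _ i] exI[of _ "Suc i + j"] exI[of _ "Suc i + k"]) auto
next
  assume ?R
  then obtain i j k where *: "i < j" "j < k" "k < length w" "x = w ! i" "z = w ! j" "y = w ! k"
    by blast
  then have "subseq [z, y] (drop (Suc i) w)"
    unfolding subseq_pair_iff
    by (intro exI[of _ "j - Suc i"] exI[of _ "k - Suc i"]) auto
  with * show ?L
    unfolding subseq_Cons_nth_iff[of x] by (intro exI[of _ i]) simp
qed

lemma order_isomorphic_1243_iff:
  "order_isomorphic v [1, 2, 4, 3] \<longleftrightarrow>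
    (\<exists>x y z t. v = [x, y, t, z] \<and> x < y \<and> y < z \<and> z < t)"
proof -
  have 4: "length v = 4 \<longleftrightarrow> (\<exists>x y t z. v = [x, y, t, z])"
    by (auto simp: numeral_eq_Suc length_Suc_conv)
  have "order_isomorphic [x, y, t, z] [1, 2, 4, 3] \<longleftrightarrow> x < y \<and> y < z \<and> z < t" for x y z t
    by (auto simp: order_isomorphic_def numeral_eq_Suc All_less_Suc2)
  moreover have "order_isomorphic v [1, 2, 4, 3] \<Longrightarrow> length v = 4"
    by (simp add: order_isomorphic_def)
  ultimately show ?thesis using 4 by blast
qed

lemma contains_1243_iff:
  "contains_pattern w [1, 2, 4, 3] \<longleftrightarrow>
    (\<exists>x y z t. subseq [x, y, t, z] w \<and> x < y \<and> y < z \<and> z < t)"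
  unfolding contains_pattern_def order_isomorphic_1243_iff by blast

text \<open>
  A maximum is known once it is known which numbers it exceeds. In this form the default value 0
  of the two statistics needs no separate treatment.
\<close>

lemma less_f_stat_iff:
  "s < f_stat w \<longleftrightarrow> (\<exists>x y. subseq [x, y] w \<and> y < x \<and> s < y)"
proof -
  have eq: "{w ! j | j. j < length w \<and> (\<exists>i < j. w ! i > w ! j)} = {y. \<exists>x. subseq [x, y] w \<and> y < x}"
    unfolding subseq_pair_iff by blast
  have "{y. \<exists>x. subseq [x, y] w \<and> y < x} \<subseteq> set w"
    by (auto simp: subseq_pair_iff)
  then have "finite {y. \<exists>x. subseq [x, y] w \<and> y < x}" by (rule finite_subset) simp
  then show ?thesis unfolding f_stat_def eq by (subst Max_gr_iff) auto
qed

lemma less_e_stat_iff: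
  "s < e_stat w \<longleftrightarrow> (\<exists>x z y. subseq [x, z, y] w \<and> x < y \<and> y < z \<and> s < x)"
proof -
  have eq: "{w ! i | i. \<exists>j k. i < j \<and> j < k \<and> k < length w \<and> w ! i < w ! k \<and> w ! k < w ! j}
      = {x. \<exists>z y. subseq [x, z, y] w \<and> x < y \<and> y < z}"
    unfolding subseq_triple_iff by blast
  have "{x. \<exists>z y. subseq [x, z, y] w \<and> x < y \<and> y < z} \<subseteq> set w"
    by (auto simp: subseq_triple_iff)
  then have "finite {x. \<exists>z y. subseq [x, z, y] w \<and> x < y \<and> y < z}" by (rule finite_subset) simp
  then show ?thesis unfolding e_stat_def eq by (subst Max_gr_iff) auto
qed

text \<open>The last two entries of a 132 form an inversion whose smaller entry exceeds the first one.\<close>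

lemma e_stat_le_f_stat: "e_stat u \<le> f_stat u"
proof (rule ccontr)
  assume "\<not> e_stat u \<le> f_stat u"
  then obtain x z y where *: "subseq [x, z, y] u" "x < y" "y < z" "f_stat u < x"
    by (auto simp: not_le less_e_stat_iff)
  then have "subseq [z, y] u" by (auto dest: subseq_Cons')
  with * have "f_stat u < f_stat u" unfolding less_f_stat_iff[of _ u] by force
  then show False by simp
qed

section \<open>Order isomorphism and spreading out values\<close>

text \<open>
  Were the entries at some position different, the smaller one would occur in the other list at a
  position where, by order isomorphism, both entries are smaller; so the two lists would already
  differ at a position with a smaller sum of entries.
\<close>

lemma order_isomorphic_same_set_imp_eq:
  assumes iso: "order_isomorphic v w" and same: "set v = set w"
  shows "v = w"
proof (rule nth_equalityI)
  show len: "length v = length w" using iso by (simp add: order_isomorphic_def)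
  have ord: "v ! i < v ! j \<longleftrightarrow> w ! i < w ! j" if "i < length v" "j < length v" for i j
    using iso that by (simp add: order_isomorphic_def)
  show "v ! i = w ! i" if "i < length v" for i
    using that
  proof (induction "v ! i + w ! i" arbitrary: i rule: less_induct)
    case less
    show ?case
    proof (cases "v ! i" "w ! i" rule: linorder_cases)
      case lt: less
      have "v ! i \<in> set w" using less.prems same nth_mem by blast
      then obtain k where k: "k < length v" "w ! k = v ! i" by (auto simp: in_set_conv_nth len)
      then have "v ! k < v ! i" using ord less.prems lt by simp
      then show ?thesis using less.hyps[of k] k lt by simp
    next
      case lt: greater
      have "w ! i \<in> set v" using less.prems same len nth_mem by metis
      then obtain k where k: "k < length v" "v ! k = w ! i" by (auto simp: in_set_conv_nth)
      then have "w ! k < w ! i" using ord[of k i] less.prems lt by simp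
      then show ?thesis using less.hyps[of k] k lt by simp
    qed
  qed
qed

text \<open>For \<open>p < q\<close> this is the increasing enumeration of the naturals other than \<open>p\<close> and \<open>q\<close>.\<close>

definition skip :: "nat \<Rightarrow> nat \<Rightarrow> nat \<Rightarrow> nat" where
  "skip p q v = (if v < p then v else if v + 1 < q then v + 1 else v + 2)"

lemma skip_less_skip_iff: "p < q \<Longrightarrow> skip p q v < skip p q v' \<longleftrightarrow> v < v'"
  by (auto simp: skip_def)

lemma less_skip_left_iff: "p < q \<Longrightarrow> p < skip p q v \<longleftrightarrow> p \<le> v"
  by (auto simp: skip_def)

lemma less_skip_right_iff: "p < q \<Longrightarrow> q < skip p q v \<longleftrightarrow> q < v + 2"
  by (auto simp: skip_def)

lemma skip_neq: "p < q \<Longrightarrow> skip p q v \<noteq> p" "p < q \<Longrightarrow> skip p q v \<noteq> q"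
  by (auto simp: skip_def)

lemma skip_image:
  assumes "1 \<le> p" "p < q" "q \<le> N + 2"
  shows "skip p q ` {1..N} = {1..N + 2} - {p, q}"
proof
  show "skip p q ` {1..N} \<subseteq> {1..N + 2} - {p, q}"
    using assms by (auto simp: skip_def)
  show "{1..N + 2} - {p, q} \<subseteq> skip p q ` {1..N}"
  proof
    fix x assume x: "x \<in> {1..N + 2} - {p, q}"
    let ?v = "if x < p then x else if x < q then x - 1 else x - 2"
    have "x = skip p q ?v" "?v \<in> {1..N}"
      using x assms by (auto simp: skip_def)
    then show "x \<in> skip p q ` {1..N}" by blast
  qed
qed

lemma subseq_map_iff: "subseq v (map g u) \<longleftrightarrow> (\<exists>v'. v = map g v' \<and> subseq v' u)"
  by (auto simp: subseq_conv_nths nths_map)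

lemma order_isomorphic_map_skip: "p < q \<Longrightarrow> order_isomorphic (map (skip p q) u) u"
  by (simp add: order_isomorphic_def skip_less_skip_iff)

lemma contains_pattern_map_skip_iff:
  assumes "p < q"
  shows "contains_pattern (map (skip p q) u) \<sigma> \<longleftrightarrow> contains_pattern u \<sigma>"
proof -
  have "order_isomorphic (map (skip p q) v) \<sigma> \<longleftrightarrow> order_isomorphic v \<sigma>" for v
    unfolding order_isomorphic_def by (simp add: skip_less_skip_iff[OF assms])
  then show ?thesis unfolding contains_pattern_def subseq_map_iff by blast
qed

lemma less_f_stat_map_skip_iff:
  assumes "p < q"
  shows "s < f_stat (map (skip p q) u) \<longleftrightarrow>
    (\<exists>x y. subseq [x, y] u \<and> y < x \<and> s < skip p q y)"
proof -
  have "(\<exists>x y. subseq [x, y] (map (skip p q) u) \<and> P x y) \<longleftrightarrow>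
      (\<exists>x y. subseq [x, y] u \<and> P (skip p q x) (skip p q y))" for P
    unfolding subseq_map_iff Cons_eq_map_conv by blast
  then show ?thesis unfolding less_f_stat_iff by (simp add: skip_less_skip_iff[OF assms])
qed

lemma less_e_stat_map_skip_iff:
  assumes "p < q"
  shows "s < e_stat (map (skip p q) u) \<longleftrightarrow>
    (\<exists>x z y. subseq [x, z, y] u \<and> x < y \<and> y < z \<and> s < skip p q x)"
proof -
  have "(\<exists>x z y. subseq [x, z, y] (map (skip p q) u) \<and> P x z y) \<longleftrightarrow>
      (\<exists>x z y. subseq [x, z, y] u \<and> P (skip p q x) (skip p q z) (skip p q y))" for P
    unfolding subseq_map_iff Cons_eq_map_conv by blast
  then show ?thesis unfolding less_e_stat_iff by (simp add: skip_less_skip_iff[OF assms])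
qed

lemma f_stat_map_skip_le_iff:
  assumes "1 \<le> p" "p < q"
  shows "f_stat (map (skip p q) u) \<le> q \<longleftrightarrow> f_stat u + 2 \<le> q"
proof -
  have "q < skip p q y \<longleftrightarrow> q - 2 < y" for y
    using assms by (auto simp: less_skip_right_iff)
  then have "q < f_stat (map (skip p q) u) \<longleftrightarrow> q - 2 < f_stat u"
    by (simp only: less_f_stat_map_skip_iff[OF assms(2)] less_f_stat_iff[of _ u])
  with assms show ?thesis by linarith
qed

lemma e_stat_map_skip_le_iff:
  assumes "1 \<le> p" "p < q"
  shows "e_stat (map (skip p q) u) \<le> p \<longleftrightarrow> e_stat u < p"
proof -
  have "p < skip p q x \<longleftrightarrow> p - 1 < x" for x
    using assms by (auto simp: less_skip_left_iff)
  then have "p < e_stat (map (skip p q) u) \<longleftrightarrow> p - 1 < e_stat u"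
    by (simp only: less_e_stat_map_skip_iff[OF assms(2)] less_e_stat_iff[of _ u])
  with assms show ?thesis by linarith
qed

text \<open>Values below \<open>p\<close> are not moved.\<close>

lemma e_stat_map_skip:
  assumes "e_stat u < p" "p < q"
  shows "e_stat (map (skip p q) u) = e_stat u"
proof -
  have "skip p q x = x" if "subseq [x, z, y] u" "x < y" "y < z" for x y z
  proof -
    have "\<not> p - 1 < x"
      using that assms less_e_stat_iff[of "p - 1" u] by force
    with assms(1) show ?thesis by (auto simp: skip_def)
  qed
  then have "s < e_stat (map (skip p q) u) \<longleftrightarrow> s < e_stat u" for s
    unfolding less_e_stat_map_skip_iff[OF assms(2)] less_e_stat_iff[of _ u] by metis
  then show ?thesis by (meson linorder_neqE_nat less_irrefl)
qed

section \<open>Putting two entries in front\<close>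

lemma alternating_Cons_Cons_iff:
  assumes "r \<noteq> []"
  shows "alternating (p # q # r) \<longleftrightarrow> p < q \<and> r ! 0 < q \<and> alternating r"
proof -
  let ?w = "p # q # r"
  let ?P = "\<lambda>i. Suc i < length ?w \<longrightarrow>
    (if even i then ?w ! i < ?w ! Suc i else ?w ! i > ?w ! Suc i)"
  have "(\<forall>i. ?P i) \<longleftrightarrow> ?P 0 \<and> ?P (Suc 0) \<and> (\<forall>i. ?P (Suc (Suc i)))"
  proof (intro iffI allI)
    fix i assume "?P 0 \<and> ?P (Suc 0) \<and> (\<forall>i. ?P (Suc (Suc i)))"
    moreover have "i = 0 \<or> i = Suc 0 \<or> (\<exists>j. i = Suc (Suc j))" by arith
    ultimately show "?P i" by blast
  qed blast
  moreover have "?P 0 \<longleftrightarrow> p < q" "?P (Suc 0) \<longleftrightarrow> r ! 0 < q"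
    using assms by simp_all
  moreover have "(\<forall>i. ?P (Suc (Suc i))) \<longleftrightarrow> alternating r"
    by (simp add: alternating_def)
  ultimately show ?thesis by (simp only: alternating_def[of ?w])
qed

lemma alternating_map_skip_iff:
  "p < q \<Longrightarrow> alternating (map (skip p q) u) \<longleftrightarrow> alternating u"
  by (simp add: alternating_def skip_less_skip_iff)

text \<open>
  Since \<open>p\<close> is the only entry before \<open>q\<close>, the entry \<open>q\<close> can only serve as the 2 after \<open>p\<close>, or as the
  1; in the latter case the smaller \<open>p\<close> could take its place.
\<close>

lemma contains_1243_Cons_Cons_iff:
  assumes "p < q"
  shows "contains_pattern (p # q # r) [1, 2, 4, 3] \<longleftrightarrow>
    contains_pattern r [1, 2, 4, 3] \<or> p < e_stat r \<or> q < f_stat r"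
    (is "?L \<longleftrightarrow> ?R")
proof
  assume ?L
  then obtain x y z t where sub: "subseq [x, y, t, z] (p # q # r)"
    and lt: "x < y" "y < z" "z < t"
    unfolding contains_1243_iff by blast
  from sub consider "subseq [x, y, t, z] r" | "p \<le> x" "subseq [y, t, z] r"
    | "y = q" "subseq [t, z] r"
    unfolding subseq_Cons_iff using assms by auto
  then show ?R
  proof cases
    case 1
    with lt show ?thesis unfolding contains_1243_iff by blast
  next
    case 2
    with lt have "p < y" by simp
    with 2 lt show ?thesis unfolding less_e_stat_iff by blast
  next
    case 3
    with lt show ?thesis unfolding less_f_stat_iff by blast
  qed
next
  assume ?R
  then consider x y z t where "subseq [x, y, t, z] r" "x < y" "y < z" "z < t"
    | y z t where "subseq [y, t, z] r" "p < y" "y < z" "z < t"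
    | z t where "subseq [t, z] r" "q < z" "z < t"
    unfolding contains_1243_iff less_e_stat_iff less_f_stat_iff by blast
  then show ?L
    unfolding contains_1243_iff subseq_Cons_iff using assms by cases blast+
qed

text \<open>
  If \<open>p\<close> is not \<open>q - 1\<close> itself, then \<open>q - 1\<close> comes after \<open>q\<close>. No value above \<open>q\<close> counts:
  the larger entry before it would lie in \<open>r\<close> as well, against the bound on \<open>f_stat r\<close>.
\<close>

lemma max_first_f_stat:
  assumes "p < q" "f_stat r \<le> q" "q \<notin> set r" "{1..<q} - {p} \<subseteq> set r"
  shows "max p (f_stat (p # q # r)) = q - 1"
proof (rule antisym)
  have "\<not> q - 1 < f_stat (p # q # r)"
  proof
    assume "q - 1 < f_stat (p # q # r)"
    then obtain x y where xy: "subseq [x, y] (p # q # r)" "y < x" "q \<le> y"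
      using assms(1) unfolding less_f_stat_iff by fastforce
    then have "subseq [x, y] r" using assms(1) by (auto simp: subseq_Cons_iff)
    moreover from this have "y \<in> set r" by (auto simp: subseq_pair_iff)
    ultimately have "q < f_stat r"
      unfolding less_f_stat_iff using xy assms(3) by (metis le_neq_implies_less)
    with assms(2) show False by simp
  qed
  with assms(1) show "max p (f_stat (p # q # r)) \<le> q - 1" by auto
  show "q - 1 \<le> max p (f_stat (p # q # r))"
  proof (cases "p = q - 1")
    case False
    with assms have "q - 1 \<in> set r" by auto
    then have "subseq [q, q - 1] (p # q # r)" by (auto simp: subseq_Cons_iff subseq_singleton_left)
    then have "q - 2 < f_stat (p # q # r)"
      unfolding less_f_stat_iff using assms(1) False by (intro exI[of _ q] exI[of _ "q - 1"]) auto
    then show ?thesis by auto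
  qed simp
qed

text \<open>A 132 starting with \<open>q\<close> would continue with an inversion of \<open>r\<close> above \<open>q\<close>.\<close>

lemma subseq_132_Cons_Cons_cases:
  assumes "f_stat r \<le> q" "subseq [x, z, y] (p # q # r)" "x < y" "y < z"
  obtains "subseq [x, z, y] r" | "x = p"
proof -
  have "\<not> (subseq [z, y] r \<and> q < y)"
    using assms(1,4) less_f_stat_iff[of q r] by auto
  with assms that show ?thesis unfolding subseq_Cons_iff by blast
qed

lemma e_stat_Cons_Cons_gap:
  assumes "1 \<le> p" "p + 1 < q" "f_stat r \<le> q" "e_stat r \<le> p" "p + 1 \<in> set r"
  shows "e_stat (p # q # r) = p"
proof (rule antisym)
  have "\<not> p < e_stat (p # q # r)"
  proof
    assume "p < e_stat (p # q # r)"
    then obtain x z y where x: "subseq [x, z, y] (p # q # r)" "x < y" "y < z" "p < x"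
      unfolding less_e_stat_iff by blast
    then have "subseq [x, z, y] r" using subseq_132_Cons_Cons_cases[OF assms(3)] by blast
    with x have "p < e_stat r" unfolding less_e_stat_iff by blast
    with assms(4) show False by simp
  qed
  then show "e_stat (p # q # r) \<le> p" by simp
  have "subseq [p, q, p + 1] (p # q # r)" using assms(5) by (auto simp: subseq_Cons_iff subseq_singleton_left)
  then have "p - 1 < e_stat (p # q # r)"
    unfolding less_e_stat_iff using assms(1,2)
    by (intro exI[of _ p] exI[of _ q] exI[of _ "p + 1"]) auto
  then show "p \<le> e_stat (p # q # r)" by simp
qed

text \<open>
  In a 132 starting with \<open>p\<close>, both other entries exceed \<open>p\<close>, and \<open>p + 1\<close> is neither of them: it
  is too small to be the 3, and as the second entry of the list it comes too early to be the 2. So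
  they would be an inversion of \<open>r\<close> above \<open>p + 1\<close>.
\<close>

lemma e_stat_Cons_Cons_adjacent:
  assumes "f_stat r \<le> Suc p" "Suc p \<notin> set r"
  shows "e_stat (p # Suc p # r) = e_stat r"
proof -
  have "subseq [x, z, y] (p # Suc p # r) \<longleftrightarrow> subseq [x, z, y] r" if "x < y" "y < z" for x y z
  proof
    assume sub: "subseq [x, z, y] (p # Suc p # r)"
    show "subseq [x, z, y] r"
      using subseq_132_Cons_Cons_cases[OF assms(1) sub that]
    proof cases
      case 2
      have "\<not> (subseq [z, y] r \<and> Suc p < y)"
        using assms(1) that less_f_stat_iff[of "Suc p" r] by auto
      moreover have "y \<noteq> Suc p" if "subseq [z, y] r"
        using that assms(2) by (metis subseq_pair_iff nth_mem)
      ultimately show ?thesis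
        using sub that 2 by (auto simp: subseq_Cons_iff)
    qed
  next
    assume "subseq [x, z, y] r"
    then show "subseq [x, z, y] (p # Suc p # r)" unfolding subseq_Cons_iff by blast
  qed
  then have "s < e_stat (p # Suc p # r) \<longleftrightarrow> s < e_stat r" for s
    unfolding less_e_stat_iff by blast
  then show ?thesis by (meson linorder_neqE_nat less_irrefl)
qed

section \<open>Children and their labels\<close>

lemma children_tail:
  assumes "set u = {1..N}" "order_isomorphic r u" "set r = {1..N + 2} - {p, q}"
    and "1 \<le> p" "p < q" "q \<le> N + 2"
  shows "r = map (skip p q) u"
proof (rule order_isomorphic_same_set_imp_eq)
  show "order_isomorphic r (map (skip p q) u)"
    using assms(2) order_isomorphic_map_skip[OF assms(5), of u]
    by (simp add: order_isomorphic_def)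
  show "set r = set (map (skip p q) u)"
    using assms skip_image[of p q N] by simp
qed

lemma children_eq:
  assumes u: "u \<in> alt_avoiding (2 * n + 1) [1, 2, 4, 3]"
  shows "children n u = {p # q # map (skip p q) u | p q.
    e_stat u < p \<and> p < q \<and> q \<le> 2 * n + 3 \<and> u ! 0 + 2 \<le> q \<and> f_stat u + 2 \<le> q}"
    (is "_ = ?C")
proof -
  have set_u: "set u = {1..2 * n + 1}" and dist_u: "distinct u" and alt_u: "alternating u"
    and avoid_u: "\<not> contains_pattern u [1, 2, 4, 3]"
    using u by (auto simp: alt_avoiding_def permutations_of_set_def)
  then have ne: "u \<noteq> []" by auto
  let ?r = "\<lambda>p q. map (skip p q) u"
  have avoid_iff: "\<not> contains_pattern (p # q # ?r p q) [1, 2, 4, 3] \<longleftrightarrow>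
      e_stat u < p \<and> f_stat u + 2 \<le> q" if "1 \<le> p" "p < q" for p q
    using that avoid_u
    by (simp add: contains_1243_Cons_Cons_iff contains_pattern_map_skip_iff not_less
        e_stat_map_skip_le_iff f_stat_map_skip_le_iff del: One_nat_def)
  have alt_iff: "alternating (p # q # ?r p q) \<longleftrightarrow> u ! 0 + 2 \<le> q" if "p < q" for p q
  proof -
    have "?r p q ! 0 < q \<longleftrightarrow> u ! 0 + 2 \<le> q"
      using less_skip_right_iff[OF that, of "u ! 0"] skip_neq(2)[OF that, of "u ! 0"] ne
      by auto
    then show ?thesis
      using that ne alt_u by (simp add: alternating_Cons_Cons_iff alternating_map_skip_iff)
  qed
  show ?thesis
  proof
    show "children n u \<subseteq> ?C"
    proof
      fix w assume "w \<in> children n u"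
      then have set_w: "set w = {1..2 * n + 3}" and dist_w: "distinct w" and alt_w: "alternating w"
        and avoid_w: "\<not> contains_pattern w [1, 2, 4, 3]" and iso: "order_isomorphic (drop 2 w) u"
        by (auto simp: children_def alt_avoiding_def permutations_of_set_def)
      have "length w = Suc (Suc (Suc (2 * n)))" using distinct_card[OF dist_w] set_w by simp
      then obtain p q r where w: "w = p # q # r" and "r \<noteq> []"
        by (auto simp: length_Suc_conv)
      then have pq: "p < q" using alt_w by (simp add: alternating_Cons_Cons_iff)
      have bounds: "1 \<le> p" "q \<le> 2 * n + 3" using set_w w by (auto simp: set_eq_iff)
      have "set r = {1..2 * n + 1 + 2} - {p, q}"
      proof -
        have "set r = set w - {p, q}" using dist_w w by auto
        then show ?thesis using set_w by (simp add: numeral_3_eq_3)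
      qed
      then have "r = ?r p q"
        using set_u iso w bounds pq by (intro children_tail) auto
      then show "w \<in> ?C"
        using avoid_iff[OF bounds(1) pq] alt_iff[OF pq] alt_w avoid_w bounds pq w by auto
    qed
    show "?C \<subseteq> children n u"
    proof
      fix w assume "w \<in> ?C"
      then obtain p q where w: "w = p # q # ?r p q" and "e_stat u < p" and pq: "p < q"
        and q: "q \<le> 2 * n + 3" and *: "u ! 0 + 2 \<le> q" "f_stat u + 2 \<le> q" by blast
      then have p: "1 \<le> p" by simp
      have set_r: "set (?r p q) = {1..2 * n + 3} - {p, q}"
        using skip_image[OF p pq, of "2 * n + 1"] q set_u by (simp add: numeral_3_eq_3)
      then have "set w = insert p (insert q ({1..2 * n + 3} - {p, q}))"
        by (simp only: w list.set)
      moreover have "\<dots> = {1..2 * n + 3}" using p pq q by auto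
      moreover have "p \<notin> set (?r p q)" "q \<notin> set (?r p q)" unfolding set_r by simp_all
      moreover have "distinct (?r p q)"
        using dist_u pq
        by (auto simp: distinct_map inj_on_def) (metis skip_less_skip_iff linorder_neqE_nat less_irrefl)
      ultimately have "w \<in> permutations_of_set {1..2 * n + 3}"
        unfolding permutations_of_set_def using w pq by simp
      moreover have "order_isomorphic (drop 2 w) u"
        using w order_isomorphic_map_skip[OF pq] by simp
      ultimately show "w \<in> children n u"
        using w avoid_iff[OF p pq] alt_iff[OF pq] * \<open>e_stat u < p\<close>
        by (simp add: children_def alt_avoiding_def)
    qed
  qed
qed

lemma label_child:
  assumes "set u = {1..2 * n + 1}" "e_stat u < p" "p < q" "q \<le> 2 * n + 3" "f_stat u + 2 \<le> q"
  shows "label (n + 1) (p # q # map (skip p q) u) =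
    (2 * int n + 4 - int q, 2 * int n + 4 - int (if q = p + 1 then e_stat u else p))"
proof -
  let ?r = "map (skip p q) u"
  have p: "1 \<le> p" using assms(2) by simp
  have set_r: "set ?r = {1..2 * n + 3} - {p, q}"
    using skip_image[OF p assms(3), of "2 * n + 1"] assms(1,4) by (simp add: numeral_3_eq_3)
  have f: "f_stat ?r \<le> q" using f_stat_map_skip_le_iff[OF p assms(3)] assms(5) by blast
  have e: "e_stat ?r \<le> p" using e_stat_map_skip_le_iff[OF p assms(3)] assms(2) by blast
  have "max p (f_stat (p # q # ?r)) = q - 1"
    by (rule max_first_f_stat[OF assms(3) f]; unfold set_r) (use assms(4) in auto)
  then have "max (int p + 1) (int (f_stat (p # q # ?r)) + 1) = int q"
    using assms(3) by linarith
  moreover have "e_stat (p # q # ?r) = (if q = p + 1 then e_stat u else p)"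
  proof (cases "q = p + 1")
    case True
    then show ?thesis
      using e_stat_Cons_Cons_adjacent[of ?r p] e_stat_map_skip[OF assms(2,3)] f set_r by simp
  next
    case False
    with assms(3) have "p + 1 < q" by simp
    moreover from this have "p + 1 \<in> set ?r" using set_r assms(4) by simp
    ultimately show ?thesis using e_stat_Cons_Cons_gap[OF p _ f e] False by simp
  qed
  ultimately show ?thesis by (simp add: label_def)
qed

theorem theorem2p4:
  fixes n :: nat and u :: "nat list" and a b :: int
  assumes "u \<in> alt_avoiding (2 * n + 1) [1, 2, 4, 3]"
    and "label n u = (a, b)"
  shows "label (n + 1) ` children n u = {(x, y). 1 \<le> x \<and> x \<le> a + 1 \<and> x + 2 \<le> y \<and> y \<le> b + 2}"
proof -
  have set_u: "set u = {1..2 * n + 1}"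
    using assms(1) by (auto simp: alt_avoiding_def permutations_of_set_def)
  have a: "a = 2 * int n + 1 - max (int (u ! 0)) (int (f_stat u))"
    and b: "b = 2 * int n + 2 - int (e_stat u)"
    using assms(2) by (auto simp: label_def)
  let ?c = "\<lambda>p q. p # q # map (skip p q) u"
  show ?thesis
  proof
    show "label (n + 1) ` children n u \<subseteq> {(x, y). 1 \<le> x \<and> x \<le> a + 1 \<and> x + 2 \<le> y \<and> y \<le> b + 2}"
    proof
      fix l assume "l \<in> label (n + 1) ` children n u"
      then obtain p q where l: "l = label (n + 1) (?c p q)"
        and pq: "e_stat u < p" "p < q" "q \<le> 2 * n + 3" "u ! 0 + 2 \<le> q" "f_stat u + 2 \<le> q"
        unfolding children_eq[OF assms(1)] by blast
      show "l \<in> {(x, y). 1 \<le> x \<and> x \<le> a + 1 \<and> x + 2 \<le> y \<and> y \<le> b + 2}"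
        unfolding l label_child[OF set_u pq(1-3,5)] a b using pq by (auto split: if_splits)
    qed
    show "{(x, y). 1 \<le> x \<and> x \<le> a + 1 \<and> x + 2 \<le> y \<and> y \<le> b + 2} \<subseteq> label (n + 1) ` children n u"
    proof clarify
      fix x y assume xy: "1 \<le> x" "x \<le> a + 1" "x + 2 \<le> y" "y \<le> b + 2"
      define q where "q = nat (2 * int n + 4 - x)"
      \<comment> \<open>The largest \<open>y\<close> comes from the adjacent pair, any other from \<open>p\<close> equal to the new
          \<open>e\<close>-statistic.\<close>
      define p where "p = (if y = b + 2 then q - 1 else nat (2 * int n + 4 - y))"
      have q: "int q = 2 * int n + 4 - x" using xy a by (simp add: q_def)
      have q_bounds: "q \<le> 2 * n + 3" "u ! 0 + 2 \<le> q" "f_stat u + 2 \<le> q"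
        using q xy a by linarith+
      have p_bounds: "e_stat u < p" "p < q"
        using q q_bounds xy b e_stat_le_f_stat[of u] by (auto simp: p_def)
      have "(x, y) = label (n + 1) (?c p q)"
        unfolding label_child[OF set_u p_bounds q_bounds(1,3)]
        using q q_bounds xy b by (auto simp: p_def)
      moreover have "?c p q \<in> children n u"
        unfolding children_eq[OF assms(1)] using p_bounds q_bounds by blast
      ultimately show "(x, y) \<in> label (n + 1) ` children n u" by blast
    qed
  qed
qed

end
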